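(* Let $G$ be a finite connected graph that admits a Hamilton path (a path visiting every vertex exactly once). Then $G$ is stackable.
   Context: Cup stacking on a finite connected graph $G$: initially one cup is placed on every vertex. A move consists of choosing a vertex $x$ carrying $r\ge 1$ cups and a vertex $y\neq x$ that carries at least one cup and satisfies $d(x,y)=r$, where $d$ is the shortest-path distance in $G$, and moving all $r$ cups from $x$ onto $y$. For a vertex $t$, $G$ is called $t$-stackable if some sequence of moves ends with all cups on $t$. $G$ is called stackable if it is $t$-stackable for every vertex $t$. *)

theory Defs
  imports "Graph_Theory.Graph_Theory"
begin

definition graph_dist :: "('a, 'b) pre_digraph \<Rightarrow> 'a \<Rightarrow> 'a \<Rightarrow> ereal" where
  "graph_dist G u v = wf_digraph.\<mu> G (\<lambda>_. 1) u v"

definition hamilton_path :: "('a, 'b) pre_digraph \<Rightarrow> 'a \<Rightarrow> 'b awalk \<Rightarrow> 'a \<Rightarrow> bool" where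
  "hamilton_path G u p v \<longleftrightarrow>
     pre_digraph.apath G u p v \<and> set (pre_digraph.awalk_verts G u p) = verts G"

text \<open>A configuration \<open>c\<close> assigns to each vertex the number of cups it carries.\<close>

definition initial_config :: "('a, 'b) pre_digraph \<Rightarrow> 'a \<Rightarrow> nat" where
  "initial_config G = (\<lambda>v. if v \<in> verts G then 1 else 0)"

definition stacked_on :: "('a, 'b) pre_digraph \<Rightarrow> 'a \<Rightarrow> 'a \<Rightarrow> nat" where
  "stacked_on G t = (\<lambda>v. if v = t then card (verts G) else 0)"

inductive cup_move :: "('a, 'b) pre_digraph \<Rightarrow> ('a \<Rightarrow> nat) \<Rightarrow> ('a \<Rightarrow> nat) \<Rightarrow> bool"
  for G where
  "\<lbrakk>x \<in> verts G; y \<in> verts G; y \<noteq> x; c x \<ge> 1; c y \<ge> 1; graph_dist G x y = ereal (real (c x))\<rbrakk>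
   \<Longrightarrow> cup_move G c (c(x := 0, y := c y + c x))"

definition stackable_at :: "('a, 'b) pre_digraph \<Rightarrow> 'a \<Rightarrow> bool" where
  "stackable_at G t \<longleftrightarrow> (cup_move G)\<^sup>*\<^sup>* (initial_config G) (stacked_on G t)"

definition stackable :: "('a, 'b) pre_digraph \<Rightarrow> bool" where
  "stackable G \<longleftrightarrow> (\<forall>t \<in> verts G. stackable_at G t)"

end

theory Submission
  imports Defs
begin

text \<open>
  Key observation: along a chain of distinct, consecutively adjacent vertices \<open>t, x\<^sub>1, \<dots>, x\<^sub>n\<close> that carry one
  cup each, all cups can be brought onto \<open>t\<close> without ever moving the cups of \<open>t\<close>. For the
  induction on \<open>n\<close> let \<open>r\<close> be the distance from \<open>x\<^sub>n\<close> to \<open>t\<close>, so \<open>1 \<le> r \<le> n\<close>. Stack the last \<open>r\<close>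
  vertices onto \<open>x\<^sub>n\<close>, move the resulting \<open>r\<close> cups from \<open>x\<^sub>n\<close> to \<open>t\<close>, and continue with the shorter
  chain \<open>t, x\<^sub>1, \<dots>, x\<^bsub>n-r\<^esub>\<close>. A vertex of a Hamilton path splits it into two such chains.
\<close>

context wf_digraph
begin

lemma successively_dominates_awalk_verts:
  assumes "awalk u p v"
  shows "successively (dominates G) (awalk_verts u p)"
  using assms
proof (induction p arbitrary: u)
  case (Cons e p)
  then show ?case
    by (cases p) (auto simp: awalk_Cons_iff successively_Cons dest: in_arcs_imp_in_arcs_ends)
qed simp

lemma successively_dominates_awalk:
  assumes "successively (dominates G) (u # xs)" "u \<in> verts G"
  shows "\<exists>p. awalk u p (last (u # xs)) \<and> length p = length xs"
  using assms
proof (induction xs arbitrary: u)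
  case Nil
  then show ?case by (auto simp: awalk_Nil_iff)
next
  case (Cons w xs)
  from Cons.prems obtain e where e: "e \<in> arcs G" "tail G e = u" "head G e = w"
    by (auto simp: arcs_ends_def arc_to_ends_def)
  moreover from this have "w \<in> verts G" by auto
  ultimately obtain p where "awalk w p (last (w # xs))" "length p = length xs"
    using Cons by auto
  with e show ?case
    by (intro exI[of _ "e # p"]) (auto simp: awalk_Cons_iff)
qed

lemma awalk_cost_one: "awalk_cost (\<lambda>_. 1) p = real (length p)"
  by (induction p) auto

end

text \<open>The chain is a walk with \<open>length xs\<close> arcs, which bounds the unit-weight
  distance from above. That distance is attained by a path, nonempty because the endpoints
  differ.\<close>

lemma (in fin_digraph) graph_dist_chain:
  assumes "successively (dominates G) (u # xs)" "u \<in> verts G" "last (u # xs) \<noteq> u"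
  shows "\<exists>r. graph_dist G u (last (u # xs)) = ereal (real r) \<and> 1 \<le> r \<and> r \<le> length xs"
proof -
  let ?v = "last (u # xs)"
  obtain p where p: "awalk u p ?v" "length p = length xs"
    using successively_dominates_awalk assms by blast
  then have "u \<rightarrow>\<^sup>* ?v" by (auto simp: reachable_awalk)
  then obtain q where q: "apath u q ?v" "\<mu> (\<lambda>_. 1) u ?v = awalk_cost (\<lambda>_. 1) q"
    using min_cost_awalk[of u ?v "\<lambda>_. 1"] by auto
  have "q \<noteq> []"
    using q(1) assms(3) by (auto simp: apath_def awalk_Nil_iff)
  moreover have "length q \<le> length xs"
    using min_cost_le_walk_cost[OF p(1), of "\<lambda>_. 1"] q(2) p(2) by (simp add: awalk_cost_one)
  ultimately show ?thesis
    using q(2) by (intro exI[of _ "length q"]) (auto simp: graph_dist_def awalk_cost_one Suc_le_eq)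
qed

context pseudo_graph
begin

lemma successively_dominates_rev:
  "successively (dominates G) (rev xs) \<longleftrightarrow> successively (dominates G) xs"
proof -
  have "(\<lambda>x y. dominates G y x) = dominates G"
    using sym_arcs arcs_ends_symmetric by (auto intro!: ext)
  then show ?thesis by (simp only: successively_rev)
qed

text \<open>Target and configuration are kept general for the induction: one recursive call stacks
  onto \<open>u\<close> instead of \<open>t\<close>, the other onto a \<open>t\<close> that already
  holds extra cups.\<close>

lemma chain_stackable:
  assumes "successively (dominates G) (t # xs)" "distinct (t # xs)" "set (t # xs) \<subseteq> verts G"
    and "\<And>x. x \<in> set xs \<Longrightarrow> c x = 1" "c t \<ge> 1"
  shows "(cup_move G)\<^sup>*\<^sup>* c (\<lambda>v. if v \<in> set xs then 0 else if v = t then c t + length xs else c v)"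
  using assms
proof (induction "length xs" arbitrary: xs t c rule: less_induct)
  case less
  show ?case
  proof (cases xs rule: rev_cases)
    case Nil
    then have "(\<lambda>v. if v \<in> set xs then 0 else if v = t then c t + length xs else c v) = c" by auto
    then show ?thesis by simp
  next
    case (snoc us u)
    \<comment> \<open>A move measures distance from source to target, so the chain is read from
      \<open>u\<close> back to \<open>t\<close>.\<close>
    have "successively (dominates G) (rev (t # xs))"
      using less.prems(1) by (simp only: successively_dominates_rev)
    then have chain: "successively (dominates G) (u # rev us @ [t])"
      using snoc by simp
    then obtain r where r: "graph_dist G u t = ereal (real r)" "1 \<le> r" "r \<le> length xs"
      using graph_dist_chain[OF chain] less.prems snoc by auto
    \<comment> \<open>\<open>zs\<close> gets \<open>r - 1\<close> vertices: with the cup on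
      \<open>u\<close> itself, exactly \<open>r\<close> cups gather there. Since
      \<open>r \<ge> 1\<close>, both \<open>ys\<close> and \<open>zs\<close> are shorter than
      \<open>xs\<close>.\<close>
    define ys zs where "ys = take (length xs - r) us" and "zs = drop (length xs - r) us"
    have us: "us = ys @ zs" and len: "length xs = length ys + r" "length zs = r - 1"
      using r snoc by (auto simp: ys_def zs_def)
    let ?c1 = "\<lambda>v. if v \<in> set (rev zs) then 0 else if v = u then c u + length (rev zs) else c v"
    let ?c2 = "?c1(u := 0, t := ?c1 t + ?c1 u)"
    let ?c3 = "\<lambda>v. if v \<in> set ys then 0 else if v = t then ?c2 t + length ys else ?c2 v"
    have "(cup_move G)\<^sup>*\<^sup>* c ?c1"
    proof (rule less.hyps)
      show "successively (dominates G) (u # rev zs)"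
        using chain us by (auto simp: successively_Cons successively_append_iff hd_append split: if_splits)
    qed (use less.prems snoc us len r in auto)
    moreover have "cup_move G ?c1 ?c2"
      by (rule cup_move.intros) (use less.prems snoc us len r in auto)
    moreover have "(cup_move G)\<^sup>*\<^sup>* ?c2 ?c3"
    proof (rule less.hyps)
      show "successively (dominates G) (t # ys)"
        using less.prems(1) snoc us
        by (auto simp: successively_Cons successively_append_iff hd_append split: if_splits)
    qed (use less.prems snoc us len r in auto)
    moreover have "?c3 = (\<lambda>v. if v \<in> set xs then 0 else if v = t then c t + length xs else c v)"
      using less.prems snoc us len r by (auto intro!: ext)
    ultimately show ?thesis by simp
  qed
qed

end

theorem theorem2p1:
  fixes G :: "('a, 'b) pre_digraph"
  assumes "graph G"
    and "Digraph_Component.connected G"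
    and "\<exists>u p v. hamilton_path G u p v"
  shows "stackable G"
  unfolding stackable_def
proof
  fix t
  assume t: "t \<in> verts G"
  interpret graph G by fact
  obtain u p v where p: "apath u p v" "set (awalk_verts u p) = verts G"
    using assms(3) by (auto simp: hamilton_path_def)
  obtain xs ys where split: "awalk_verts u p = xs @ t # ys"
    using t p(2) by (metis split_list)
  have "successively (dominates G) (xs @ t # ys)" and dist: "distinct (xs @ t # ys)"
    and verts: "verts G = set (xs @ t # ys)"
    using p split successively_dominates_awalk_verts[of u p v] by (auto simp: apath_def)
  \<comment> \<open>Both chains must start at \<open>t\<close>, so the part before \<open>t\<close>
    is reversed.\<close>
  then have "successively (dominates G) (rev (xs @ [t]))" and right: "successively (dominates G) (t # ys)"
    unfolding successively_dominates_rev by (auto simp: successively_append_iff successively_Cons)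
  then have left: "successively (dominates G) (t # rev xs)" by simp
  let ?c0 = "initial_config G"
  let ?c1 = "\<lambda>v. if v \<in> set (rev xs) then 0 else if v = t then ?c0 t + length (rev xs) else ?c0 v"
  let ?c2 = "\<lambda>v. if v \<in> set ys then 0 else if v = t then ?c1 t + length ys else ?c1 v"
  have "(cup_move G)\<^sup>*\<^sup>* ?c0 ?c1"
    by (rule chain_stackable) (use left dist verts in \<open>auto simp: initial_config_def\<close>)
  \<comment> \<open>Here \<open>t\<close> already holds \<open>1 + length xs\<close> cups, while
    each vertex of \<open>ys\<close> still has one.\<close>
  moreover have "(cup_move G)\<^sup>*\<^sup>* ?c1 ?c2"
    by (rule chain_stackable) (use right dist verts in \<open>auto simp: initial_config_def\<close>)
  moreover have "?c2 = stacked_on G t"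
  proof -
    have "card (verts G) = Suc (length xs + length ys)"
      using distinct_card[OF dist] verts by simp
    then show ?thesis
      using dist verts by (auto simp: stacked_on_def initial_config_def intro!: ext)
  qed
  ultimately show "stackable_at G t"
    unfolding stackable_at_def by (metis rtranclp_trans)
qed

end
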